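(* The linearly ordered set $([0,1]^{<\omega_1}_{\searrow 0},<_{altlex})$ can be represented by $\mathbf{\Delta}^0_2$ subsets of $\mathcal{K}([0,1]^2)$ ordered by inclusion, i.e. there is a map $\bar x\mapsto\mathcal{A}^{\bar x}$ from $[0,1]^{<\omega_1}_{\searrow 0}$ into $\mathbf{\Delta}^0_2(\mathcal{K}([0,1]^2))$ such that $\bar x<_{altlex}\bar y$ implies $\mathcal{A}^{\bar x}\subsetneqq\mathcal{A}^{\bar y}$.
   Context: $\mathcal{K}([0,1]^2)$ is the space of nonempty compact subsets of $[0,1]^2$ with the Hausdorff metric; $\mathbf{\Delta}^0_2$ denotes sets that are both $F_\sigma$ and $G_\delta$. $[0,1]^{<\omega_1}_{\searrow 0}$ is the set of strictly decreasing transfinite sequences $(x_\alpha)_{\alpha\le\xi}$ ($\xi<\omega_1$) in $[0,1]$ with last element $0$. Parity of $\gamma+n$ ($\gamma$ limit or $0$, $n<\omega$) is that of $n$. For distinct $\bar x,\bar x'$ with $\delta$ the least index where they differ, $\bar x<_{altlex}\bar x'$ iff ($\delta$ even and $x_\delta<x'_\delta$) or ($\delta$ odd and $x_\delta>x'_\delta$). *)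

theory Defs
  imports "HOL-Analysis.Analysis"
begin

section \<open>The hyperspace of nonempty compact sets\<close>

definition compacts_in :: "'a::metric_space set \<Rightarrow> 'a set set" where
  "compacts_in X = {K. compact K \<and> K \<noteq> {} \<and> K \<subseteq> X}"

text \<open>The value \<open>0\<close> outside the nonempty bounded sets is a dummy: the locale
  \<^locale>\<open>Metric_space\<close> asks for a nonnegative symmetric function on the whole type.\<close>

definition hausdorff_dist :: "'a::metric_space set \<Rightarrow> 'a set \<Rightarrow> real" where
  "hausdorff_dist K L =
    (if K \<noteq> {} \<and> L \<noteq> {} \<and> bounded K \<and> bounded L
     then max (SUP x\<in>K. infdist x L) (SUP y\<in>L. infdist y K) else 0)"

lemma bdd_above_infdist:
  assumes "bounded K" "L \<noteq> {}"
  shows "bdd_above ((\<lambda>x. infdist x L) ` K)"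
proof -
  obtain l where l: "l \<in> L" using assms by auto
  obtain e where e: "\<forall>x\<in>K. dist l x \<le> e" using assms(1) bounded_any_center by metis
  show ?thesis
    by (rule bdd_aboveI2[where M=e]) (metis e dist_commute infdist_le l order_trans)
qed

lemma Metric_space_hausdorff: "Metric_space (compacts_in X) hausdorff_dist"
proof
  fix K L :: "'a set"
  show "0 \<le> hausdorff_dist K L"
  proof (cases "K \<noteq> {} \<and> L \<noteq> {} \<and> bounded K \<and> bounded L")
    case True
    then obtain k where k: "k \<in> K" by auto
    have "0 \<le> infdist k L" by (rule infdist_nonneg)
    also have "\<dots> \<le> (SUP x\<in>K. infdist x L)"
      using True k by (intro cSUP_upper bdd_above_infdist) auto
    finally show ?thesis using True by (simp add: hausdorff_dist_def)
  qed (auto simp: hausdorff_dist_def)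
  show "hausdorff_dist K L = hausdorff_dist L K"
    by (auto simp: hausdorff_dist_def max.commute)
next
  have upper: "infdist x L \<le> hausdorff_dist K L" "infdist y K \<le> hausdorff_dist K L"
    if "K \<in> compacts_in X" "L \<in> compacts_in X" "x \<in> K" "y \<in> L" for K L x y
  proof -
    have *: "K \<noteq> {} \<and> L \<noteq> {} \<and> bounded K \<and> bounded L"
      using that by (auto simp: compacts_in_def compact_imp_bounded)
    have "infdist x L \<le> (SUP x\<in>K. infdist x L)"
      using * that by (intro cSUP_upper bdd_above_infdist) auto
    moreover have "infdist y K \<le> (SUP y\<in>L. infdist y K)"
      using * that by (intro cSUP_upper bdd_above_infdist) auto
    ultimately show "infdist x L \<le> hausdorff_dist K L" "infdist y K \<le> hausdorff_dist K L"
      using * by (auto simp: hausdorff_dist_def)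
  qed
  have least: "hausdorff_dist K L \<le> c"
    if "K \<in> compacts_in X" "L \<in> compacts_in X"
      "\<And>x. x \<in> K \<Longrightarrow> infdist x L \<le> c" "\<And>y. y \<in> L \<Longrightarrow> infdist y K \<le> c" for K L c
    using that by (auto simp: hausdorff_dist_def compacts_in_def compact_imp_bounded
        intro!: cSUP_least)
  fix K L :: "'a set"
  assume K: "K \<in> compacts_in X" and L: "L \<in> compacts_in X"
  have cl: "closed K" "closed L" "K \<noteq> {}" "L \<noteq> {}"
    using K L by (auto simp: compacts_in_def compact_imp_closed)
  show "hausdorff_dist K L = 0 \<longleftrightarrow> K = L"
  proof
    assume 0: "hausdorff_dist K L = 0"
    have "x \<in> L" if "x \<in> K" for x
      using upper(1)[OF K L that] cl 0 infdist_nonneg[of x L]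
      by (metis all_not_in_conv in_closed_iff_infdist_zero order_antisym)
    moreover have "y \<in> K" if "y \<in> L" for y
      using upper(2)[OF K L _ that] cl 0 infdist_nonneg[of y K]
      by (metis all_not_in_conv in_closed_iff_infdist_zero order_antisym)
    ultimately show "K = L" by blast
  next
    assume "K = L"
    then show "hausdorff_dist K L = 0"
      using cl K by (simp add: hausdorff_dist_def compacts_in_def compact_imp_bounded)
  qed
  fix N :: "'a set"
  assume N: "N \<in> compacts_in X"
  have tri: "infdist x B \<le> a + b"
    if "\<And>y. y \<in> A \<Longrightarrow> infdist y B \<le> b" "infdist x A \<le> a" "A \<noteq> {}" for x :: 'a and A B a b
  proof -
    have "infdist x B - b \<le> infdist x A"
      unfolding infdist_notempty[OF \<open>A \<noteq> {}\<close>]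
    proof (rule cINF_greatest[OF \<open>A \<noteq> {}\<close>])
      fix y assume "y \<in> A"
      then show "infdist x B - b \<le> dist x y"
        using that(1)[of y] infdist_triangle[of x B y] by linarith
    qed
    then show ?thesis using that(2) by linarith
  qed
  obtain k l n where kln: "k \<in> K" "l \<in> L" "n \<in> N"
    using K L N by (auto simp: compacts_in_def)
  show "hausdorff_dist K N \<le> hausdorff_dist K L + hausdorff_dist L N"
  proof (rule least[OF K N])
    fix x assume "x \<in> K"
    then show "infdist x N \<le> hausdorff_dist K L + hausdorff_dist L N"
      using upper[OF K L] upper[OF L N] kln cl by (intro tri[of L]) blast+
  next
    fix y assume "y \<in> N"
    then have "infdist y K \<le> hausdorff_dist L N + hausdorff_dist K L"
      using upper[OF K L] upper[OF L N] kln cl by (intro tri[of L]) blast+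
    then show "infdist y K \<le> hausdorff_dist K L + hausdorff_dist L N" by simp
  qed
qed

definition hyperspace :: "'a::metric_space set \<Rightarrow> 'a set topology" where
  "hyperspace X = Metric_space.mtopology (compacts_in X) hausdorff_dist"

lemma topspace_hyperspace: "topspace (hyperspace X) = compacts_in X"
  by (simp add: hyperspace_def Metric_space.topspace_mtopology[OF Metric_space_hausdorff])

definition delta02_in :: "'a topology \<Rightarrow> 'a set \<Rightarrow> bool" where
  "delta02_in X S \<longleftrightarrow> fsigma_in X S \<and> gdelta_in X S"

section \<open>Countable ordinals\<close>

text \<open>The countable ordinals, realised as the field of the successor cardinal of
  \<^const>\<open>natLeq\<close>, a well-order of type \<open>\<omega>\<^sub>1\<close>
  (see \<open>countable_atMost_omega1\<close> and \<open>uncountable_omega1\<close> below).\<close>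

typedef omega1 = "Field (cardSuc natLeq)"
  using Field_cardSuc_not_empty[OF natLeq_Card_order] by auto

instantiation omega1 :: linorder
begin

definition less_eq_omega1 :: "omega1 \<Rightarrow> omega1 \<Rightarrow> bool" where
  "\<alpha> \<le> \<beta> \<longleftrightarrow> (Rep_omega1 \<alpha>, Rep_omega1 \<beta>) \<in> cardSuc natLeq"

definition less_omega1 :: "omega1 \<Rightarrow> omega1 \<Rightarrow> bool" where
  "(\<alpha>::omega1) < \<beta> \<longleftrightarrow> \<alpha> \<le> \<beta> \<and> \<alpha> \<noteq> \<beta>"

instance
proof
  have W: "Well_order (cardSuc natLeq)"
    by (rule cardSuc_Well_order[OF natLeq_Card_order])
  then have refl: "refl_on (Field (cardSuc natLeq)) (cardSuc natLeq)"
    and tr: "trans (cardSuc natLeq)" and anti: "antisym (cardSuc natLeq)"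
    and tot: "total_on (Field (cardSuc natLeq)) (cardSuc natLeq)"
    by (auto simp: order_on_defs)
  fix x y z :: omega1
  show xx: "x \<le> x"
    using refl Rep_omega1 unfolding less_eq_omega1_def refl_on_def by auto
  show "x \<le> y \<Longrightarrow> y \<le> z \<Longrightarrow> x \<le> z"
    using tr unfolding less_eq_omega1_def by (meson transD)
  show anti': "x \<le> y \<Longrightarrow> y \<le> x \<Longrightarrow> x = y"
    using anti unfolding less_eq_omega1_def by (meson antisymD Rep_omega1_inject)
  show "x < y \<longleftrightarrow> x \<le> y \<and> \<not> y \<le> x"
    using anti' xx unfolding less_omega1_def by blast
  show "x \<le> y \<or> y \<le> x"
    using tot Rep_omega1[of x] Rep_omega1[of y] xx
    unfolding less_eq_omega1_def total_on_def by (metis Rep_omega1_inject)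
qed

end

instance omega1 :: wellorder
proof (rule wf_wellorderI)
  have "wf (cardSuc natLeq - Id)"
    using cardSuc_Well_order[OF natLeq_Card_order] by (simp add: well_order_on_def)
  moreover have "{(x, y). x < (y::omega1)} \<subseteq> inv_image (cardSuc natLeq - Id) Rep_omega1"
    by (auto simp: less_omega1_def less_eq_omega1_def Rep_omega1_inject)
  ultimately show "wf {(x, y). x < (y::omega1)}"
    using wf_inv_image wf_subset by blast
qed intro_classes

context
  includes cardinal_syntax
begin

lemma countable_card_le_natLeq: "countable A \<longleftrightarrow> |A| \<le>o natLeq"
proof -
  have "countable A \<longleftrightarrow> |A| \<le>o |UNIV :: nat set|"
    by (simp add: countable_def card_of_ordLeq[symmetric])
  also have "\<dots> \<longleftrightarrow> |A| \<le>o natLeq"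
    using card_of_nat ordLeq_ordIso_trans ordIso_symmetric by blast
  finally show ?thesis .
qed

lemma countable_atMost_omega1: "countable {..\<alpha>::omega1}"
proof -
  let ?r = "cardSuc natLeq"
  have C: "Card_order ?r" by (rule cardSuc_Card_order[OF natLeq_Card_order])
  have "|underS ?r (Rep_omega1 \<alpha>)| <o ?r"
    using C Rep_omega1 by (rule card_of_underS)
  then have "|underS ?r (Rep_omega1 \<alpha>)| \<le>o natLeq"
    by (simp add: cardSuc_ordLeq_ordLess[OF natLeq_Card_order card_of_Card_order])
  then have "countable (underS ?r (Rep_omega1 \<alpha>))"
    by (simp add: countable_card_le_natLeq)
  moreover have "Rep_omega1 ` {..<\<alpha>} \<subseteq> underS ?r (Rep_omega1 \<alpha>)"
    by (auto simp: underS_def less_omega1_def less_eq_omega1_def Rep_omega1_inject)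
  ultimately have "countable (Rep_omega1 ` {..<\<alpha>})"
    by (rule countable_subset[rotated])
  then have "countable {..<\<alpha>}"
    by (rule countable_image_inj_on) (simp add: inj_on_def Rep_omega1_inject)
  then show ?thesis
    by (metis countable_insert ivl_disj_un_singleton(2) sup_commute insert_is_Un)
qed

lemma uncountable_omega1: "uncountable (UNIV :: omega1 set)"
proof
  let ?r = "cardSuc natLeq"
  assume "countable (UNIV :: omega1 set)"
  then have "countable (range Rep_omega1)" by (rule countable_image)
  moreover have "range Rep_omega1 = Field ?r"
    using type_definition.Rep_range[OF type_definition_omega1] .
  ultimately have "|Field ?r| \<le>o natLeq" by (simp add: countable_card_le_natLeq)
  then have "?r \<le>o natLeq"
    using card_of_Field_ordIso[OF cardSuc_Card_order[OF natLeq_Card_order]]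
      ordIso_ordLeq_trans ordIso_symmetric by blast
  then show False
    using cardSuc_greater[OF natLeq_Card_order] not_ordLess_ordLeq by blast
qed

end

lemma ex_greater_omega1: "\<exists>\<beta>. (\<alpha>::omega1) < \<beta>"
proof (rule ccontr)
  assume "\<not> ?thesis"
  then have "(UNIV :: omega1 set) = {..\<alpha>}" by (auto simp: not_less)
  then show False using countable_atMost_omega1 uncountable_omega1 by metis
qed

definition osuc :: "omega1 \<Rightarrow> omega1" where
  "osuc \<alpha> = (LEAST \<beta>. \<alpha> < \<beta>)"

definition zero_or_limit :: "omega1 \<Rightarrow> bool" where
  "zero_or_limit \<gamma> \<longleftrightarrow> (\<forall>\<alpha><\<gamma>. osuc \<alpha> < \<gamma>)"

definition even_ord :: "omega1 \<Rightarrow> bool" where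
  "even_ord \<alpha> \<longleftrightarrow> (\<exists>\<gamma> n. zero_or_limit \<gamma> \<and> \<alpha> = (osuc ^^ n) \<gamma> \<and> even n)"

definition odd_ord :: "omega1 \<Rightarrow> bool" where
  "odd_ord \<alpha> \<longleftrightarrow> (\<exists>\<gamma> n. zero_or_limit \<gamma> \<and> \<alpha> = (osuc ^^ n) \<gamma> \<and> odd n)"

lemma less_osuc: "\<alpha> < osuc \<alpha>"
  unfolding osuc_def using ex_greater_omega1 by (rule LeastI_ex)

lemma osuc_le_iff: "osuc \<alpha> \<le> \<beta> \<longleftrightarrow> \<alpha> < \<beta>"
proof
  show "osuc \<alpha> \<le> \<beta> \<Longrightarrow> \<alpha> < \<beta>" using less_osuc by (rule less_le_trans)
  show "\<alpha> < \<beta> \<Longrightarrow> osuc \<alpha> \<le> \<beta>" unfolding osuc_def by (rule Least_le)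
qed

lemma osuc_inject: "osuc \<alpha> = osuc \<beta> \<longleftrightarrow> \<alpha> = \<beta>"
proof
  assume eq: "osuc \<alpha> = osuc \<beta>"
  have "\<not> \<alpha> < \<beta>" using eq osuc_le_iff[of \<alpha> \<beta>] less_osuc[of \<beta>] by (metis leD)
  moreover have "\<not> \<beta> < \<alpha>" using eq osuc_le_iff[of \<beta> \<alpha>] less_osuc[of \<alpha>] by (metis leD)
  ultimately show "\<alpha> = \<beta>" by simp
qed simp

lemma not_zero_or_limit_osuc: "\<not> zero_or_limit (osuc \<alpha>)"
  unfolding zero_or_limit_def using less_osuc[of \<alpha>] less_irrefl by blast

lemma ord_decomposition: "\<exists>\<gamma> n. zero_or_limit \<gamma> \<and> \<alpha> = (osuc ^^ n) \<gamma>"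
proof (induction \<alpha> rule: less_induct)
  case (less \<alpha>)
  show ?case
  proof (cases "zero_or_limit \<alpha>")
    case True
    then have "zero_or_limit \<alpha> \<and> \<alpha> = (osuc ^^ 0) \<alpha>" by simp
    then show ?thesis by blast
  next
    case False
    then obtain \<beta> where b: "\<beta> < \<alpha>" "\<alpha> = osuc \<beta>"
      unfolding zero_or_limit_def using osuc_le_iff by (metis order_le_less)
    then obtain \<gamma> n where "zero_or_limit \<gamma>" "\<beta> = (osuc ^^ n) \<gamma>" using less by blast
    then have "zero_or_limit \<gamma> \<and> \<alpha> = (osuc ^^ Suc n) \<gamma>" using b by simp
    then show ?thesis by blast
  qed
qed

lemma ord_decomposition_unique:
  assumes "zero_or_limit \<gamma>" "zero_or_limit \<delta>" "(osuc ^^ n) \<gamma> = (osuc ^^ m) \<delta>"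
  shows "\<gamma> = \<delta> \<and> n = m"
  using assms(3)
proof (induction n arbitrary: m)
  case 0
  then show ?case using assms(1) not_zero_or_limit_osuc by (cases m) auto
next
  case (Suc n)
  then show ?case using assms(2) not_zero_or_limit_osuc
    by (cases m) (auto simp: osuc_inject)
qed

lemma odd_ord_iff: "odd_ord \<alpha> \<longleftrightarrow> \<not> even_ord \<alpha>"
proof
  show "odd_ord \<alpha> \<Longrightarrow> \<not> even_ord \<alpha>"
    unfolding odd_ord_def even_ord_def using ord_decomposition_unique by blast
  show "\<not> even_ord \<alpha> \<Longrightarrow> odd_ord \<alpha>"
    unfolding odd_ord_def even_ord_def using ord_decomposition[of \<alpha>] by blast
qed

section \<open>Decreasing transfinite sequences\<close>

text \<open>A sequence \<open>(x\<^sub>\<alpha>)\<^bsub>\<alpha>\<le>\<xi>\<^esub>\<close> is the partial function with domain \<open>{..\<xi>}\<close>.\<close>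

definition decr_seqs :: "(omega1 \<rightharpoonup> real) set" where
  "decr_seqs = {x. \<exists>\<xi>. dom x = {..\<xi>} \<and> ran x \<subseteq> {0..1}
      \<and> (\<forall>\<alpha> \<beta>. \<alpha> < \<beta> \<and> \<beta> \<le> \<xi> \<longrightarrow> the (x \<beta>) < the (x \<alpha>)) \<and> x \<xi> = Some 0}"

text \<open>On \<^const>\<open>decr_seqs\<close> the index \<open>\<delta>\<close> always lies in both domains
  (\<open>decr_seqs_first_difference\<close>), so \<^const>\<open>the\<close> is only applied to actual terms.\<close>

definition altlex :: "(omega1 \<rightharpoonup> real) \<Rightarrow> (omega1 \<rightharpoonup> real) \<Rightarrow> bool" where
  "altlex x y \<longleftrightarrow> (\<exists>\<delta>. (\<forall>\<alpha><\<delta>. x \<alpha> = y \<alpha>) \<and> x \<delta> \<noteq> y \<delta> \<and>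
      (even_ord \<delta> \<and> the (x \<delta>) < the (y \<delta>) \<or> odd_ord \<delta> \<and> the (x \<delta>) > the (y \<delta>)))"

lemma decr_seqs_domD:
  assumes x: "x \<in> decr_seqs" and y: "y \<in> decr_seqs"
    and eq: "\<forall>\<alpha><\<delta>. x \<alpha> = y \<alpha>" and d: "\<delta> \<in> dom x"
  shows "\<delta> \<in> dom y"
proof (rule ccontr)
  assume nd: "\<delta> \<notin> dom y"
  from x obtain \<xi> where \<xi>: "dom x = {..\<xi>}" "ran x \<subseteq> {0..1}"
    "\<forall>\<alpha> \<beta>. \<alpha> < \<beta> \<and> \<beta> \<le> \<xi> \<longrightarrow> the (x \<beta>) < the (x \<alpha>)"
    by (auto simp: decr_seqs_def)
  from y obtain \<eta> where \<eta>: "dom y = {..\<eta>}" "y \<eta> = Some 0"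
    by (auto simp: decr_seqs_def)
  have lt: "\<eta> < \<delta>" using nd \<eta> by (simp add: not_le)
  then have "x \<eta> = Some 0" using eq \<eta> by simp
  moreover have "the (x \<delta>) < the (x \<eta>)" using lt d \<xi> by simp
  moreover have "0 \<le> the (x \<delta>)"
  proof -
    obtain r where r: "x \<delta> = Some r" using d by blast
    then have "r \<in> {0..1}" using \<xi>(2) ranI subsetD by metis
    then show ?thesis using r by simp
  qed
  ultimately show False by simp
qed

lemma decr_seqs_first_difference:
  assumes "x \<in> decr_seqs" "y \<in> decr_seqs" "x \<noteq> y"
  obtains \<delta> where "\<forall>\<alpha><\<delta>. x \<alpha> = y \<alpha>" "x \<delta> \<noteq> y \<delta>" "\<delta> \<in> dom x" "\<delta> \<in> dom y"
proof -
  define \<delta> where "\<delta> = (LEAST \<delta>. x \<delta> \<noteq> y \<delta>)"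
  have "\<exists>\<delta>. x \<delta> \<noteq> y \<delta>" using assms(3) by auto
  then have ne: "x \<delta> \<noteq> y \<delta>" unfolding \<delta>_def by (rule LeastI_ex)
  moreover have eq: "\<forall>\<alpha><\<delta>. x \<alpha> = y \<alpha>" unfolding \<delta>_def using not_less_Least by blast
  moreover have "\<delta> \<in> dom x \<or> \<delta> \<in> dom y" using ne by (auto simp: dom_def)
  ultimately show ?thesis
    using that[of \<delta>] decr_seqs_domD[OF assms(1,2)] decr_seqs_domD[OF assms(2,1)] by metis
qed

lemma altlex_irrefl: "\<not> altlex x x"
  by (simp add: altlex_def)

lemma altlex_total:
  assumes "x \<in> decr_seqs" "y \<in> decr_seqs" "x \<noteq> y"
  shows "altlex x y \<or> altlex y x"
proof -
  obtain \<delta> where d: "\<forall>\<alpha><\<delta>. x \<alpha> = y \<alpha>" "x \<delta> \<noteq> y \<delta>" "\<delta> \<in> dom x" "\<delta> \<in> dom y"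
    using decr_seqs_first_difference[OF assms] .
  then have "the (x \<delta>) \<noteq> the (y \<delta>)" by (metis domD option.sel)
  then have "the (x \<delta>) < the (y \<delta>) \<or> the (y \<delta>) < the (x \<delta>)" by linarith
  with d odd_ord_iff[of \<delta>] show ?thesis unfolding altlex_def by metis
qed

lemma altlex_trans:
  assumes xy: "altlex x y" and yz: "altlex y z"
  shows "altlex x z"
proof -
  let ?P = "\<lambda>\<delta> x y. even_ord \<delta> \<and> the (x \<delta>) < the (y \<delta>) \<or> odd_ord \<delta> \<and> the (x \<delta>) > the (y \<delta>)"
  obtain a where a: "\<forall>\<alpha><a. x \<alpha> = y \<alpha>" "x a \<noteq> y a" "?P a x y"
    using xy unfolding altlex_def by blast
  obtain b where b: "\<forall>\<alpha><b. y \<alpha> = z \<alpha>" "y b \<noteq> z b" "?P b y z"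
    using yz unfolding altlex_def by blast
  consider "a < b" | "b < a" | "a = b" by fastforce
  then show ?thesis
  proof cases
    case 1
    then have "y a = z a" "\<forall>\<alpha><a. y \<alpha> = z \<alpha>" using b(1) by auto
    then have "\<forall>\<alpha><a. x \<alpha> = z \<alpha>" "x a \<noteq> z a" "?P a x z" using a by simp_all
    then show ?thesis unfolding altlex_def by blast
  next
    case 2
    then have "x b = y b" "\<forall>\<alpha><b. x \<alpha> = y \<alpha>" using a(1) by auto
    then have "\<forall>\<alpha><b. x \<alpha> = z \<alpha>" "x b \<noteq> z b" "?P b x z" using b by simp_all
    then show ?thesis unfolding altlex_def by blast
  next
    case 3
    have b': "?P a y z" "\<forall>\<alpha><a. y \<alpha> = z \<alpha>" using b 3 by (simp_all only:)
    have P: "?P a x z" using a(3) b'(1) odd_ord_iff[of a] by (metis order.strict_trans)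
    moreover have "x a \<noteq> z a" using P by (metis less_irrefl)
    moreover have "\<forall>\<alpha><a. x \<alpha> = z \<alpha>" using a(1) b'(2) by simp
    ultimately show ?thesis unfolding altlex_def by blast
  qed
qed

end

theory Submission
  imports Defs
begin

text \<open>Each sequence \<open>x\<close> prescribes, for every index \<open>\<alpha>\<close>, a closed condition on compact sets \<open>K\<close>
  that involves only the terms of \<open>x\<close> up to \<open>\<alpha>\<close>; \<open>K\<close> belongs to \<open>\<A> x\<close> iff the first
  condition that \<open>K\<close> violates has odd index. Since \<open>x\<close> has countable length, this is a countable
  Boolean combination giving a \<open>\<Delta>\<^sup>0\<^sub>2\<close> set. The conditions are arranged so that, when \<open>\<delta>\<close> is the
  first difference and \<open>x\<^sub>\<delta> < y\<^sub>\<delta>\<close>, the \<open>\<delta>\<close>-th condition of \<open>x\<close> implies that of \<open>y\<close> but contradicts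
  the \<open>(\<delta>+1)\<close>-st condition of \<open>y\<close>. Hence a set first failing \<open>x\<close> after \<open>\<delta>\<close> first fails \<open>y\<close> exactly at
  \<open>\<delta>+1\<close>, which gives the inclusion in the direction determined by the parity of \<open>\<delta>\<close>. The
  \<open>(\<delta>+1)\<close>-st condition asks \<open>K\<close> to meet \<open>{y\<^sub>\<delta>} \<times> [0, y\<^bsub>\<delta>+1\<^esub>]\<close>; the limit points of the markers
  \<open>(y\<^sub>\<beta>, y\<^bsub>\<beta>+1\<^esub>)\<close> with \<open>\<beta>+1 < \<delta>\<close> stay above this segment even when \<open>y\<^sub>\<delta>\<close> is the infimum of the
  preceding terms, which is what the second coordinate is for.\<close>

section \<open>Closed and \<open>\<Delta>\<^sup>0\<^sub>2\<close> sets in the hyperspace\<close>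

text \<open>The infimum of the distances from \<open>k\<close> to \<open>L\<close> is strictly below
  \<open>r\<close>, hence so is one of these distances.\<close>

lemma hausdorff_dist_less_imp_close:
  assumes "K \<in> compacts_in X" "L \<in> compacts_in X" "hausdorff_dist K L < r" "k \<in> K"
  shows "\<exists>l\<in>L. dist k l < r"
proof -
  have K: "K \<noteq> {}" "bounded K" and L: "L \<noteq> {}" "bounded L"
    using assms(1,2) by (auto simp: compacts_in_def compact_imp_bounded)
  have "infdist k L \<le> (SUP x\<in>K. infdist x L)"
    using K L assms(4) by (intro cSUP_upper bdd_above_infdist) auto
  also have "\<dots> \<le> hausdorff_dist K L"
    using K L by (simp add: hausdorff_dist_def)
  finally have "(INF l\<in>L. dist k l) < r"
    using assms(3) L by (simp add: infdist_notempty)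
  then show ?thesis
    using L by (subst (asm) cInf_less_iff) auto
qed

text \<open>A point of \<open>K\<close> outside \<open>D\<close> has a ball missing
  \<open>D\<close>, and every \<open>L\<close> close enough to \<open>K\<close> has a point in that
  ball.\<close>

lemma closedin_hyperspace_subset:
  assumes "closed D"
  shows "closedin (hyperspace X) {K \<in> compacts_in X. K \<subseteq> D}"
proof -
  interpret Metric_space "compacts_in X" hausdorff_dist by (rule Metric_space_hausdorff)
  have "\<exists>r>0. mball K r \<subseteq> compacts_in X - {K \<in> compacts_in X. K \<subseteq> D}"
    if K: "K \<in> compacts_in X" and "\<not> K \<subseteq> D" for K
  proof -
    obtain k where k: "k \<in> K" "k \<in> - D" using \<open>\<not> K \<subseteq> D\<close> by auto
    obtain r where r: "r > 0" "ball k r \<subseteq> - D"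
      using k(2) assms openE[of "- D" k] by (auto simp: open_Compl)
    have "\<not> L \<subseteq> D" if "L \<in> compacts_in X" "hausdorff_dist K L < r" for L
      using hausdorff_dist_less_imp_close[OF K that k(1)] r(2) by (auto simp: subset_iff)
    then have "mball K r \<subseteq> compacts_in X - {K \<in> compacts_in X. K \<subseteq> D}"
      unfolding subset_iff in_mball by blast
    then show ?thesis using r(1) by blast
  qed
  then show ?thesis
    unfolding hyperspace_def by (auto simp: closedin_def openin_mtopology)
qed

text \<open>A compact \<open>K\<close> missing \<open>V\<close> has a positive distance
  \<open>r\<close> from it, and no set within \<open>r\<close> of \<open>K\<close> can reach
  \<open>V\<close>.\<close>

lemma closedin_hyperspace_meets:
  fixes V :: "'a::heine_borel set"
  assumes "closed V"
  shows "closedin (hyperspace X) {K \<in> compacts_in X. K \<inter> V \<noteq> {}}"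
proof -
  interpret Metric_space "compacts_in X" hausdorff_dist by (rule Metric_space_hausdorff)
  have "\<exists>r>0. mball K r \<subseteq> compacts_in X - {K \<in> compacts_in X. K \<inter> V \<noteq> {}}"
    if K: "K \<in> compacts_in X" and "K \<inter> V = {}" for K
  proof -
    have "compact K" using K by (simp add: compacts_in_def)
    then obtain r where r: "r > 0" "\<forall>k\<in>K. \<forall>v\<in>V. r \<le> dist k v"
      using separate_compact_closed[of K V] assms \<open>K \<inter> V = {}\<close> by metis
    have "L \<inter> V = {}" if L: "L \<in> compacts_in X" "hausdorff_dist K L < r" for L
    proof (rule ccontr)
      assume "L \<inter> V \<noteq> {}"
      then obtain l where l: "l \<in> L" "l \<in> V" by auto
      have "hausdorff_dist L K < r" using L(2) by (simp add: commute)
      then obtain k where "k \<in> K" "dist l k < r"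
        using hausdorff_dist_less_imp_close[OF L(1) K _ l(1)] by auto
      then show False using r(2) l(2) by (metis dist_commute not_le)
    qed
    then have "mball K r \<subseteq> compacts_in X - {K \<in> compacts_in X. K \<inter> V \<noteq> {}}"
      unfolding subset_iff in_mball by blast
    then show ?thesis using r(1) by blast
  qed
  then show ?thesis
    unfolding hyperspace_def by (auto simp: closedin_def openin_mtopology)
qed

lemma metrizable_space_hyperspace: "metrizable_space (hyperspace X)"
proof -
  interpret Metric_space "compacts_in X" hausdorff_dist by (rule Metric_space_hausdorff)
  show ?thesis unfolding hyperspace_def by (rule metrizable_space_mtopology)
qed

text \<open>Exiting exactly at \<alpha> is a closed condition intersected with an open one, hence
  F-sigma in a metrizable space. Since \<open>P \<eta>\<close> is empty, all exits occur among the
  countably many indices up to \<eta>. Replacing \<open>S\<close> by its complement yields the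
  G-delta half.\<close>

lemma delta02_in_Least_nonmember:
  fixes P :: "omega1 \<Rightarrow> 'a set"
  assumes X: "metrizable_space X" and P: "\<And>\<alpha>. closedin X (P \<alpha>)" and "P \<eta> = {}"
  shows "delta02_in X {k \<in> topspace X. (LEAST \<alpha>. k \<notin> P \<alpha>) \<in> S}"
proof -
  let ?R = "\<lambda>k. LEAST \<alpha>. k \<notin> P \<alpha>"
  have R: "k \<notin> P (?R k)" "?R k \<le> \<eta>" for k
    using LeastI[of "\<lambda>\<alpha>. k \<notin> P \<alpha>" \<eta>] Least_le[of "\<lambda>\<alpha>. k \<notin> P \<alpha>" \<eta>] \<open>P \<eta> = {}\<close> by simp_all
  have R_less: "k \<in> P \<gamma>" if "\<gamma> < ?R k" for k \<gamma>
    using not_less_Least[OF that] by simp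
  have R_eq: "?R k = \<alpha>" if "\<forall>\<gamma><\<alpha>. k \<in> P \<gamma>" "k \<notin> P \<alpha>" for k \<alpha>
    using that by (intro Least_equality) (auto simp: not_less[symmetric])
  have fsigma: "fsigma_in X {k \<in> topspace X. ?R k \<in> T}" for T
  proof -
    let ?E = "\<lambda>\<alpha>. (topspace X \<inter> (\<Inter>\<gamma>\<in>{..<\<alpha>}. P \<gamma>)) \<inter> (topspace X - P \<alpha>)"
    have "fsigma_in X (?E \<alpha>)" for \<alpha>
    proof (rule fsigma_in_Int)
      \<comment> \<open>Inserting \<open>topspace X\<close> keeps the family nonempty when no index
        lies below \<alpha>.\<close>
      have "closedin X (\<Inter>(insert (topspace X) (P ` {..<\<alpha>})))"
        using P by (intro closedin_Inter) auto
      then show "fsigma_in X (topspace X \<inter> (\<Inter>\<gamma>\<in>{..<\<alpha>}. P \<gamma>))"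
        by (simp add: closed_imp_fsigma_in)
      show "fsigma_in X (topspace X - P \<alpha>)"
        using open_imp_fsigma_in[OF X] P by blast
    qed
    moreover have "countable (T \<inter> {..\<eta>})"
      using countable_atMost_omega1 by auto
    ultimately have "fsigma_in X (\<Union>(?E ` (T \<inter> {..\<eta>})))"
      by (intro fsigma_in_Union) auto
    also have "\<Union>(?E ` (T \<inter> {..\<eta>})) = {k \<in> topspace X. ?R k \<in> T}"
    proof (intro subset_antisym subsetI)
      fix k assume "k \<in> \<Union>(?E ` (T \<inter> {..\<eta>}))"
      then show "k \<in> {k \<in> topspace X. ?R k \<in> T}"
        using R_eq[of _ k] by auto
    next
      fix k assume "k \<in> {k \<in> topspace X. ?R k \<in> T}"
      then have "?R k \<in> T \<inter> {..\<eta>}" "k \<in> ?E (?R k)"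
        using R[of k] R_less[of _ k] by auto
      then show "k \<in> \<Union>(?E ` (T \<inter> {..\<eta>}))" by (rule UN_I)
    qed
    finally show ?thesis .
  qed
  have "topspace X - {k \<in> topspace X. ?R k \<in> S} = {k \<in> topspace X. ?R k \<in> - S}"
    by auto
  then show ?thesis
    unfolding delta02_in_def gdelta_in_fsigma_in using fsigma[of S] fsigma[of "- S"] by auto
qed

section \<open>The conditions attached to a decreasing sequence\<close>

lemma decr_seqs_dom_down:
  assumes "x \<in> decr_seqs" "\<alpha> \<in> dom x" "\<beta> \<le> \<alpha>"
  shows "\<beta> \<in> dom x"
proof -
  obtain \<xi> where "dom x = {..\<xi>}" using assms(1) by (auto simp: decr_seqs_def)
  then show ?thesis using assms(2,3) by simp
qed

lemma decr_seqs_less: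
  assumes "x \<in> decr_seqs" "\<beta> \<in> dom x" "\<alpha> < \<beta>"
  shows "the (x \<beta>) < the (x \<alpha>)"
proof -
  obtain \<xi> where "dom x = {..\<xi>}" "\<forall>\<alpha> \<beta>. \<alpha> < \<beta> \<and> \<beta> \<le> \<xi> \<longrightarrow> the (x \<beta>) < the (x \<alpha>)"
    using assms(1) by (auto simp: decr_seqs_def)
  then show ?thesis using assms(2,3) by auto
qed

lemma decr_seqs_le:
  assumes "x \<in> decr_seqs" "\<beta> \<in> dom x" "\<alpha> \<le> \<beta>"
  shows "the (x \<beta>) \<le> the (x \<alpha>)"
  using decr_seqs_less[OF assms(1,2)] assms(3) by (cases "\<alpha> = \<beta>") (auto simp: less_le)

lemma decr_seqs_range:
  assumes "x \<in> decr_seqs" "\<alpha> \<in> dom x"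
  shows "the (x \<alpha>) \<in> {0..1}"
proof -
  obtain r where r: "x \<alpha> = Some r" using assms(2) by blast
  have "ran x \<subseteq> {0..1}" using assms(1) by (auto simp: decr_seqs_def)
  then show ?thesis using ranI[of x \<alpha> r, OF r] r by auto
qed

lemma decr_seqs_osuc_dom:
  assumes "x \<in> decr_seqs" "\<alpha> \<in> dom x" "the (x \<alpha>) > 0"
  shows "osuc \<alpha> \<in> dom x"
proof -
  obtain \<xi> where \<xi>: "dom x = {..\<xi>}" "x \<xi> = Some 0"
    using assms(1) by (auto simp: decr_seqs_def)
  then have "\<alpha> < \<xi>" using assms(2,3) by (cases "\<alpha> = \<xi>") auto
  then show ?thesis using \<xi>(1) by (simp add: osuc_le_iff)
qed

text \<open>The strict bound uses terms before \<alpha> alone, so sequences first differing at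
  \<alpha> still share these markers. The pair with \<open>osuc \<beta> = \<alpha>\<close> is
  covered by the segment in \<open>region\<close>.\<close>

definition markers :: "(omega1 \<rightharpoonup> real) \<Rightarrow> omega1 \<Rightarrow> (real \<times> real) set" where
  "markers x \<alpha> = {(the (x \<beta>), the (x (osuc \<beta>))) |\<beta>. osuc \<beta> < \<alpha>}"

definition segment :: "(omega1 \<rightharpoonup> real) \<Rightarrow> omega1 \<Rightarrow> (real \<times> real) set" where
  "segment x \<beta> = {the (x \<beta>)} \<times> {..the (x (osuc \<beta>))}"

definition region :: "(omega1 \<rightharpoonup> real) \<Rightarrow> omega1 \<Rightarrow> (real \<times> real) set" where
  "region x \<alpha> = closure (markers x \<alpha>) \<union> {..the (x \<alpha>)} \<times> UNIV \<union> (\<Union>\<beta>\<in>{\<beta>. osuc \<beta> = \<alpha>}. segment x \<beta>)"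

text \<open>The domain conjunct empties every stage past the last index, so each \<open>K\<close>
  violates some condition. At zero and at limits the meeting condition is vacuous.\<close>

definition stage :: "(real \<times> real) set \<Rightarrow> (omega1 \<rightharpoonup> real) \<Rightarrow> omega1 \<Rightarrow> (real \<times> real) set set" where
  "stage Q x \<alpha> = {K \<in> compacts_in Q. \<alpha> \<in> dom x \<and> K \<subseteq> region x \<alpha>
      \<and> (\<forall>\<beta>. osuc \<beta> = \<alpha> \<longrightarrow> K \<inter> segment x \<beta> \<noteq> {})}"

lemma closed_segment: "closed (segment x \<beta>)"
  unfolding segment_def by (intro closed_Times) auto

lemma closed_region: "closed (region x \<alpha>)"
proof -
  \<comment> \<open>By injectivity of \<open>osuc\<close> there is at most one predecessor, so the
    union of segments stays closed.\<close>
  have "finite {\<beta>. osuc \<beta> = \<alpha>}"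
    using finite_subset[of "{\<beta>. osuc \<beta> = \<alpha>}" "{THE \<beta>. osuc \<beta> = \<alpha>}"]
    by (force simp: osuc_inject)
  then show ?thesis
    unfolding region_def by (intro closed_Un closed_UN closed_Times ballI closed_segment) auto
qed

lemma closedin_stage: "closedin (hyperspace Q) (stage Q x \<alpha>)"
proof (cases "\<alpha> \<in> dom x")
  case True
  then have "stage Q x \<alpha> = \<Inter>(insert {K \<in> compacts_in Q. K \<subseteq> region x \<alpha>}
      ((\<lambda>\<beta>. {K \<in> compacts_in Q. K \<inter> segment x \<beta> \<noteq> {}}) ` {\<beta>. osuc \<beta> = \<alpha>}))"
    unfolding stage_def by auto
  also have "closedin (hyperspace Q) \<dots>"
    by (intro closedin_Inter)
      (auto intro: closedin_hyperspace_subset closedin_hyperspace_meets closed_region closed_segment)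
  finally show ?thesis .
next
  case False
  then show ?thesis by (simp add: stage_def)
qed

section \<open>Comparing the stages of two sequences at their first difference\<close>

lemma markers_cong:
  assumes "\<forall>\<alpha><\<delta>. x \<alpha> = y \<alpha>"
  shows "markers x \<delta> = markers y \<delta>"
proof -
  have "x \<beta> = y \<beta>" "x (osuc \<beta>) = y (osuc \<beta>)" if "osuc \<beta> < \<delta>" for \<beta>
    using assms that less_osuc[of \<beta>] less_trans by blast+
  then show ?thesis unfolding markers_def by (intro Collect_cong) metis
qed

lemma stage_cong:
  assumes "\<forall>\<alpha>\<le>\<delta>. x \<alpha> = y \<alpha>"
  shows "stage Q x \<delta> = stage Q y \<delta>"
proof -
  have eq: "x \<delta> = y \<delta>" "markers x \<delta> = markers y \<delta>"
    using assms by (simp, intro markers_cong) simp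
  have "segment x \<beta> = segment y \<beta>" if "osuc \<beta> = \<delta>" for \<beta>
  proof -
    have "x \<beta> = y \<beta>" using assms that less_osuc[of \<beta>] by auto
    then show ?thesis using that eq(1) by (simp add: segment_def)
  qed
  then show ?thesis using eq unfolding stage_def region_def by (simp add: dom_def cong: conj_cong)
qed

text \<open>The markers agree, the half-plane grows, and a segment keeps its vertical line while its
  top rises: both containment and meeting become easier.\<close>

lemma stage_mono:
  assumes "\<forall>\<alpha><\<delta>. x \<alpha> = y \<alpha>" "\<delta> \<in> dom y" "the (x \<delta>) \<le> the (y \<delta>)"
  shows "stage Q x \<delta> \<subseteq> stage Q y \<delta>"
proof -
  have seg: "segment x \<beta> \<subseteq> segment y \<beta>" if "osuc \<beta> = \<delta>" for \<beta>
  proof -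
    have "x \<beta> = y \<beta>" using assms(1) that less_osuc[of \<beta>] by auto
    then show ?thesis using assms(3) that by (auto simp: segment_def)
  qed
  then have "region x \<delta> \<subseteq> region y \<delta>"
    using markers_cong[OF assms(1)] assms(3) unfolding region_def by fastforce
  then show ?thesis
    using seg assms(2) unfolding stage_def by blast
qed

text \<open>The point avoids all three parts: limits of markers have height at least
  \<open>y\<^sub>\<delta>\<close>, the half-plane stops at \<open>x\<^sub>\<delta>\<close>, and a
  segment of a predecessor lies on a line strictly to the right of
  \<open>y\<^sub>\<delta>\<close>.\<close>

lemma not_in_region:
  assumes y: "y \<in> decr_seqs" and eq: "\<forall>\<alpha><\<delta>. x \<alpha> = y \<alpha>" and d: "\<delta> \<in> dom y"
    and less: "the (x \<delta>) < the (y \<delta>)" and t: "t < the (y \<delta>)"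
  shows "(the (y \<delta>), t) \<notin> region x \<delta>"
proof -
  have "markers y \<delta> \<subseteq> UNIV \<times> {the (y \<delta>)..}"
    using decr_seqs_less[OF y d] by (force simp: markers_def)
  then have "closure (markers y \<delta>) \<subseteq> UNIV \<times> {the (y \<delta>)..}"
    by (intro closure_minimal closed_Times) auto
  then have "(the (y \<delta>), t) \<notin> closure (markers x \<delta>)"
    using t markers_cong[OF eq] by auto
  moreover have "(the (y \<delta>), t) \<notin> segment x \<beta>" if "osuc \<beta> = \<delta>" for \<beta>
  proof -
    have b: "\<beta> < \<delta>" using that less_osuc[of \<beta>] by auto
    then have "the (y \<delta>) < the (x \<beta>)" using decr_seqs_less[OF y d b] eq by auto
    then show ?thesis by (simp add: segment_def)
  qed
  ultimately show ?thesis using less by (auto simp: region_def)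
qed

lemma stage_disjoint_next:
  assumes y: "y \<in> decr_seqs" and eq: "\<forall>\<alpha><\<delta>. x \<alpha> = y \<alpha>" and d: "\<delta> \<in> dom y"
    and less: "the (x \<delta>) < the (y \<delta>)"
  shows "stage Q x \<delta> \<inter> stage Q y (osuc \<delta>) = {}"
proof (rule ccontr)
  assume "\<not> ?thesis"
  then obtain K where K: "K \<subseteq> region x \<delta>" "osuc \<delta> \<in> dom y" "K \<inter> segment y \<delta> \<noteq> {}"
    unfolding stage_def by blast
  then obtain t where "(the (y \<delta>), t) \<in> region x \<delta>" "t \<le> the (y (osuc \<delta>))"
    by (auto simp: segment_def)
  then show False
    using not_in_region[OF y eq d less] decr_seqs_less[OF y K(2) less_osuc] by fastforce
qed

text \<open>According to the position of \<alpha>, a marker lies in the half-plane, is the top of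
  the segment, or is already a marker for \<alpha>.\<close>

lemma markers_subset_region:
  assumes y: "y \<in> decr_seqs" and d: "\<delta> \<in> dom y" and le: "\<alpha> \<le> \<delta>"
  shows "markers y (osuc \<delta>) \<subseteq> region y \<alpha>"
proof
  fix p assume "p \<in> markers y (osuc \<delta>)"
  then obtain \<beta> where p: "p = (the (y \<beta>), the (y (osuc \<beta>)))" and b: "osuc \<beta> < osuc \<delta>"
    by (auto simp: markers_def)
  have bd: "\<beta> \<in> dom y"
    using decr_seqs_dom_down[OF y d] b osuc_le_iff
    by (metis less_osuc less_le_not_le linorder_not_less order_trans)
  consider "\<alpha> \<le> \<beta>" | "osuc \<beta> = \<alpha>" | "osuc \<beta> < \<alpha>"
    using osuc_le_iff[of \<beta> \<alpha>] by fastforce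
  then show "p \<in> region y \<alpha>"
  proof cases
    case 1
    then show ?thesis using decr_seqs_le[OF y bd] by (auto simp: region_def p)
  next
    case 2
    then show ?thesis by (auto simp: region_def p segment_def)
  next
    case 3
    then have "p \<in> markers y \<alpha>" by (auto simp: markers_def p)
    then show ?thesis using closure_subset by (auto simp: region_def)
  qed
qed

text \<open>The witness is the closure of the markers up to \<delta> plus one point on the line at
  \<open>y\<^sub>\<delta>\<close>. Each marker is the top of its segment, which settles the meeting
  conditions through \<delta>.\<close>

lemma stage_separating_set:
  assumes y: "y \<in> decr_seqs" and eq: "\<forall>\<alpha><\<delta>. x \<alpha> = y \<alpha>" and d: "\<delta> \<in> dom y"
    and pos: "0 < the (y \<delta>)" and less: "the (x \<delta>) < the (y \<delta>)"
  obtains K where "K \<in> compacts_in ({0..1} \<times> {0..1})"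
    "\<forall>\<alpha>\<le>\<delta>. K \<in> stage ({0..1} \<times> {0..1}) y \<alpha>"
    "K \<notin> stage ({0..1} \<times> {0..1}) x \<delta>" "K \<notin> stage ({0..1} \<times> {0..1}) y (osuc \<delta>)"
proof -
  let ?Q = "{0..1} \<times> {0..1} :: (real \<times> real) set"
  have d': "osuc \<delta> \<in> dom y" by (rule decr_seqs_osuc_dom[OF y d pos])
  have lt: "the (y (osuc \<delta>)) < the (y \<delta>)" by (rule decr_seqs_less[OF y d' less_osuc])
  \<comment> \<open>Height below \<open>y\<^sub>\<delta>\<close> puts the extra point outside
    \<open>region x \<delta>\<close>; height above the next term keeps it off
    \<open>segment y \<delta>\<close>.\<close>
  define t where "t = (the (y \<delta>) + the (y (osuc \<delta>))) / 2"
  have t: "t < the (y \<delta>)" "the (y (osuc \<delta>)) < t" using lt by (auto simp: t_def)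
  \<comment> \<open>The inserted point also makes \<open>K\<close> nonempty when there are no
    markers.\<close>
  define K where "K = insert (the (y \<delta>), t) (closure (markers y (osuc \<delta>)))"
  have range: "the (y \<beta>) \<in> {0..1}" if "\<beta> \<le> osuc \<delta>" for \<beta>
    using decr_seqs_range[OF y decr_seqs_dom_down[OF y d' that]] .
  have "markers y (osuc \<delta>) \<subseteq> ?Q"
  proof
    fix p assume "p \<in> markers y (osuc \<delta>)"
    then obtain \<beta> where p: "p = (the (y \<beta>), the (y (osuc \<beta>)))" and b: "osuc \<beta> < osuc \<delta>"
      by (auto simp: markers_def)
    have "\<beta> \<le> osuc \<delta>" using b less_osuc[of \<beta>] by (meson less_imp_le order_trans)
    then show "p \<in> ?Q" using range[of \<beta>] range[of "osuc \<beta>"] b by (auto simp: p)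
  qed
  then have "closure (markers y (osuc \<delta>)) \<subseteq> ?Q"
    by (intro closure_minimal closed_Times) auto
  moreover have "(the (y \<delta>), t) \<in> ?Q"
    using range[of \<delta>] range[of "osuc \<delta>"] t less_imp_le[OF less_osuc, of \<delta>] by auto
  ultimately have KQ: "K \<subseteq> ?Q" by (simp add: K_def)
  have "bounded K"
    by (rule bounded_subset[OF _ KQ]) (intro bounded_Times; simp)
  then have "compact K"
    by (simp add: compact_eq_bounded_closed K_def)
  with KQ have K: "K \<in> compacts_in ?Q" by (auto simp: compacts_in_def K_def)
  have reg: "K \<subseteq> region y \<alpha>" if "\<alpha> \<le> \<delta>" for \<alpha>
  proof -
    have "closure (markers y (osuc \<delta>)) \<subseteq> region y \<alpha>"
      by (intro closure_minimal closed_region markers_subset_region[OF y d that])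
    moreover have "(the (y \<delta>), t) \<in> region y \<alpha>"
      using decr_seqs_le[OF y d that] by (simp add: region_def)
    ultimately show ?thesis by (simp add: K_def)
  qed
  have "K \<in> stage ?Q y \<alpha>" if a: "\<alpha> \<le> \<delta>" for \<alpha>
  proof -
    have "K \<inter> segment y \<beta> \<noteq> {}" if "osuc \<beta> = \<alpha>" for \<beta>
    proof -
      have "osuc \<beta> < osuc \<delta>" using that a less_osuc[of \<delta>] by auto
      then have "(the (y \<beta>), the (y (osuc \<beta>))) \<in> markers y (osuc \<delta>)"
        by (auto simp: markers_def)
      then have "(the (y \<beta>), the (y (osuc \<beta>))) \<in> K"
        using closure_subset by (auto simp: K_def)
      then show ?thesis by (auto simp: segment_def)
    qed
    then show ?thesis
      using K reg[OF a] decr_seqs_dom_down[OF y d a] by (simp add: stage_def)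
  qed
  moreover have "K \<notin> stage ?Q x \<delta>"
    using not_in_region[OF y eq d less t(1)] by (auto simp: stage_def K_def)
  moreover have "K \<notin> stage ?Q y (osuc \<delta>)"
  proof -
    have "markers y (osuc \<delta>) \<subseteq> UNIV \<times> {the (y \<delta>)..}"
    proof
      fix p assume "p \<in> markers y (osuc \<delta>)"
      then obtain \<beta> where p: "p = (the (y \<beta>), the (y (osuc \<beta>)))" and b: "osuc \<beta> < osuc \<delta>"
        by (auto simp: markers_def)
      have "osuc \<beta> \<le> \<delta>" using b osuc_le_iff[of \<delta> "osuc \<beta>"] by (simp add: not_le[symmetric])
      then show "p \<in> UNIV \<times> {the (y \<delta>)..}" using decr_seqs_le[OF y d] by (simp add: p)
    qed
    then have "closure (markers y (osuc \<delta>)) \<subseteq> UNIV \<times> {the (y \<delta>)..}"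
      by (intro closure_minimal closed_Times) auto
    then have "K \<inter> segment y \<delta> = {}"
      using t lt by (auto simp: K_def segment_def)
    then show ?thesis by (auto simp: stage_def)
  qed
  ultimately show ?thesis using that K by blast
qed

section \<open>The index of the first violated condition\<close>

definition exit_index :: "(real \<times> real) set \<Rightarrow> (omega1 \<rightharpoonup> real) \<Rightarrow> (real \<times> real) set \<Rightarrow> omega1" where
  "exit_index Q x K = (LEAST \<alpha>. K \<notin> stage Q x \<alpha>)"

lemma exit_index_eqI:
  assumes "\<forall>\<alpha><\<gamma>. K \<in> stage Q x \<alpha>" "K \<notin> stage Q x \<gamma>"
  shows "exit_index Q x K = \<gamma>"
  unfolding exit_index_def using assms
  by (intro Least_equality) (auto simp: not_less[symmetric])

lemma stage_empty:
  assumes "x \<in> decr_seqs"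
  shows "\<exists>\<eta>. stage Q x \<eta> = {}"
proof -
  obtain \<xi> where "dom x = {..\<xi>}" using assms by (auto simp: decr_seqs_def)
  then have "osuc \<xi> \<notin> dom x" using less_osuc[of \<xi>] by (simp add: not_le)
  then show ?thesis by (auto simp: stage_def)
qed

lemma exit_index_stage:
  assumes "x \<in> decr_seqs"
  shows "K \<notin> stage Q x (exit_index Q x K)" "\<alpha> < exit_index Q x K \<Longrightarrow> K \<in> stage Q x \<alpha>"
proof -
  have "\<exists>\<eta>. K \<notin> stage Q x \<eta>" using stage_empty[OF assms] by blast
  then show "K \<notin> stage Q x (exit_index Q x K)"
    unfolding exit_index_def by (rule LeastI_ex)
  show "\<alpha> < exit_index Q x K \<Longrightarrow> K \<in> stage Q x \<alpha>"
    unfolding exit_index_def using not_less_Least by blast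
qed

text \<open>Stages before \<delta> coincide. Surviving \<delta> for \<open>x\<close> forces survival
  through \<delta> for \<open>y\<close> by \<open>stage_mono\<close>, then failure at the next index
  by \<open>stage_disjoint_next\<close>.\<close>

lemma exit_index_cases:
  assumes x: "x \<in> decr_seqs" and y: "y \<in> decr_seqs" and eq: "\<forall>\<alpha><\<delta>. x \<alpha> = y \<alpha>"
    and d: "\<delta> \<in> dom y" and less: "the (x \<delta>) < the (y \<delta>)"
  shows "exit_index Q x K = exit_index Q y K \<or> exit_index Q x K = \<delta> \<or> exit_index Q y K = osuc \<delta>"
proof -
  let ?a = "exit_index Q x K"
  have st: "stage Q x \<alpha> = stage Q y \<alpha>" if "\<alpha> < \<delta>" for \<alpha>
    using eq that by (intro stage_cong) auto
  consider "?a < \<delta>" | "?a = \<delta>" | "\<delta> < ?a" by fastforce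
  then show ?thesis
  proof cases
    case 1
    then have "exit_index Q y K = ?a"
      using exit_index_stage[OF x, where K = K and Q = Q] st by (intro exit_index_eqI) auto
    then show ?thesis by simp
  next
    case 3
    have "K \<in> stage Q y \<alpha>" if "\<alpha> < osuc \<delta>" for \<alpha>
    proof -
      have "\<alpha> \<le> \<delta>" using that osuc_le_iff[of \<delta> \<alpha>] by (simp add: not_le[symmetric])
      then have "K \<in> stage Q x \<alpha>" using 3 by (intro exit_index_stage(2)[OF x]) auto
      then show ?thesis
        using st[of \<alpha>] stage_mono[OF eq d less_imp_le[OF less]] \<open>\<alpha> \<le> \<delta>\<close> by (cases "\<alpha> = \<delta>") auto
    qed
    moreover have "K \<notin> stage Q y (osuc \<delta>)"
      using stage_disjoint_next[OF y eq d less] exit_index_stage(2)[OF x 3] by blast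
    ultimately show ?thesis using exit_index_eqI by blast
  qed simp
qed

lemma exit_index_separated:
  assumes x: "x \<in> decr_seqs" and y: "y \<in> decr_seqs" and eq: "\<forall>\<alpha><\<delta>. x \<alpha> = y \<alpha>"
    and d: "\<delta> \<in> dom x" "\<delta> \<in> dom y" and less: "the (x \<delta>) < the (y \<delta>)"
  obtains K where "K \<in> compacts_in ({0..1} \<times> {0..1})"
    "exit_index ({0..1} \<times> {0..1}) x K = \<delta>" "exit_index ({0..1} \<times> {0..1}) y K = osuc \<delta>"
proof -
  let ?Q = "{0..1} \<times> {0..1} :: (real \<times> real) set"
  \<comment> \<open>Positivity guarantees that \<open>y\<close> has a term after \<delta>, which the
    separating set uses.\<close>
  have pos: "0 < the (y \<delta>)" using decr_seqs_range[OF x d(1)] less by simp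
  obtain K where K: "K \<in> compacts_in ?Q" "\<forall>\<alpha>\<le>\<delta>. K \<in> stage ?Q y \<alpha>"
    "K \<notin> stage ?Q x \<delta>" "K \<notin> stage ?Q y (osuc \<delta>)"
    using stage_separating_set[OF y eq d(2) pos less] .
  have "stage ?Q x \<alpha> = stage ?Q y \<alpha>" if "\<alpha> < \<delta>" for \<alpha>
    using eq that by (intro stage_cong) auto
  then have "exit_index ?Q x K = \<delta>" using K by (intro exit_index_eqI) auto
  moreover have "exit_index ?Q y K = osuc \<delta>"
  proof (rule exit_index_eqI)
    show "\<forall>\<alpha><osuc \<delta>. K \<in> stage ?Q y \<alpha>"
      using K(2) osuc_le_iff[of \<delta>] by (simp add: not_le[symmetric])
  qed (rule K(4))
  ultimately show ?thesis using that K(1) by blast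
qed

section \<open>Parity of the exit index and the representing map\<close>

lemma odd_ord_osuc: "odd_ord (osuc \<alpha>) \<longleftrightarrow> even_ord \<alpha>"
proof -
  obtain \<gamma> n where g: "zero_or_limit \<gamma>" "\<alpha> = (osuc ^^ n) \<gamma>" using ord_decomposition by blast
  have s: "osuc \<alpha> = (osuc ^^ Suc n) \<gamma>" using g(2) by simp
  show ?thesis
  proof (cases "even n")
    case True
    then have "even_ord \<alpha>" "odd_ord (osuc \<alpha>)"
      unfolding even_ord_def odd_ord_def using g s by (metis even_Suc)+
    then show ?thesis by simp
  next
    case False
    then have "odd_ord \<alpha>" "even_ord (osuc \<alpha>)"
      unfolding even_ord_def odd_ord_def using g s by (metis even_Suc)+
    then show ?thesis using odd_ord_iff by blast
  qed
qed

theorem theorem3p8: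
  shows "\<exists>\<A> :: (omega1 \<rightharpoonup> real) \<Rightarrow> (real \<times> real) set set.
    (\<forall>x\<in>decr_seqs. delta02_in (hyperspace ({0..1} \<times> {0..1})) (\<A> x)) \<and>
    (\<forall>x\<in>decr_seqs. \<forall>y\<in>decr_seqs. altlex x y \<longrightarrow> \<A> x \<subset> \<A> y)"
proof -
  let ?Q = "{0..1} \<times> {0..1} :: (real \<times> real) set"
  let ?e = "exit_index ?Q"
  define \<A> where "\<A> x = {K \<in> compacts_in ?Q. odd_ord (?e x K)}" for x
  have "delta02_in (hyperspace ?Q) (\<A> x)" if x: "x \<in> decr_seqs" for x
  proof -
    obtain \<eta> where "stage ?Q x \<eta> = {}" using stage_empty[OF x] by blast
    then show ?thesis
      using delta02_in_Least_nonmember[OF metrizable_space_hyperspace closedin_stage, where S = "Collect odd_ord"]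
      by (simp add: \<A>_def exit_index_def topspace_hyperspace)
  qed
  moreover have "\<A> x \<subset> \<A> y" if x: "x \<in> decr_seqs" and y: "y \<in> decr_seqs" and "altlex x y" for x y
  proof -
    obtain \<delta> where eq: "\<forall>\<alpha><\<delta>. x \<alpha> = y \<alpha>" and ne: "x \<delta> \<noteq> y \<delta>"
      and cmp: "even_ord \<delta> \<and> the (x \<delta>) < the (y \<delta>) \<or> odd_ord \<delta> \<and> the (x \<delta>) > the (y \<delta>)"
      using \<open>altlex x y\<close> unfolding altlex_def by blast
    have eq': "\<forall>\<alpha><\<delta>. y \<alpha> = x \<alpha>" using eq by simp
    have "\<delta> \<in> dom x \<or> \<delta> \<in> dom y" using ne by (auto simp: dom_def)
    then have d: "\<delta> \<in> dom x" "\<delta> \<in> dom y"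
      using decr_seqs_domD[OF x y eq] decr_seqs_domD[OF y x eq'] by blast+
    from cmp show ?thesis
    proof (elim disjE conjE)
      assume ev: "even_ord \<delta>" and less: "the (x \<delta>) < the (y \<delta>)"
      have par: "\<not> odd_ord \<delta>" "odd_ord (osuc \<delta>)" using ev odd_ord_iff odd_ord_osuc by auto
      have "\<A> x \<subseteq> \<A> y"
        \<comment> \<open>For even \<delta>, an exit of \<open>x\<close> at \<delta> excludes
          \<open>K\<close> from \<open>\<A> x\<close>, and an exit of \<open>y\<close> at
          \<open>osuc \<delta>\<close> puts it into \<open>\<A> y\<close>.\<close>
        using exit_index_cases[OF x y eq d(2) less, where Q = ?Q] par unfolding \<A>_def by (intro Collect_mono) metis
      moreover obtain K where "K \<in> compacts_in ?Q" "?e x K = \<delta>" "?e y K = osuc \<delta>"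
        using exit_index_separated[OF x y eq d less] .
      then have "K \<in> \<A> y - \<A> x" using par by (simp add: \<A>_def)
      ultimately show ?thesis by blast
    next
      assume od: "odd_ord \<delta>" and less: "the (x \<delta>) > the (y \<delta>)"
      have par: "odd_ord \<delta>" "\<not> odd_ord (osuc \<delta>)" using od odd_ord_iff odd_ord_osuc by auto
      have "\<A> x \<subseteq> \<A> y"
        \<comment> \<open>The roles of \<open>x\<close> and \<open>y\<close> are exchanged; the odd
          parity of \<delta> reverses the inclusion back.\<close>
        using exit_index_cases[OF y x eq' d(1) less, where Q = ?Q] par unfolding \<A>_def by (intro Collect_mono) metis
      moreover obtain K where "K \<in> compacts_in ?Q" "?e y K = \<delta>" "?e x K = osuc \<delta>"
        using exit_index_separated[OF y x eq' d(2,1) less] .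
      then have "K \<in> \<A> y - \<A> x" using par by (simp add: \<A>_def)
      ultimately show ?thesis by blast
    qed
  qed
  ultimately show ?thesis by (intro exI[of _ \<A>]) blast
qed

end
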